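(* Let $m,A,B$ be fixed positive integers. For each integer $n\ge1$ let $S_n$ be the number of white balls drawn from the urn $\mathcal{U}_{A,B}$ in the first $n$ time steps, and set $$W_n=\sqrt{\frac{(A+B+m)n}{AB(A+B+nm)}}\left[A-\frac{(A+B)S_n}{n}\right].$$ Then $W_n$ has mean zero and variance $1$. Moreover, for $Z$ a standard normal random variable, if $n\ge\frac{A+B+m}{2m}$ then $$\|\mathcal{L}(W_{n+1})-\mathcal{L}(Z)\|_1\le\left(\frac{4mn}{A+B+m}+\frac{A^2+6AB+B^2}{AB}\right)\sqrt{\frac{(A+B+m)^3}{AB(A+B+nm+m)(n+1)}},$$ while if $n<\frac{A+B+m}{2m}$ then $$\|\mathcal{L}(W_{n+1})-\mathcal{L}(Z)\|_1\le\left(\frac{A^2+8AB+B^2}{AB}\right)\sqrt{\frac{(A+B+m)^3}{AB(A+B+nm+m)(n+1)}}.$$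
   Context: Pólya–Eggenberger urn $\mathcal{U}_{A,B}$ (with parameter $m$): the urn initially contains $A$ white and $B$ black balls; at each time step one ball is drawn uniformly at random from the urn and is returned along with $m$ additional balls of the same color. Thus when $S_n=k$ the urn contains $A+km$ white balls and $B+(n-k)m$ black balls. $\mathcal{L}(X)$ denotes the distribution of $X$, and $\|\mathcal{L}(X)-\mathcal{L}(Y)\|_1=\int_{-\infty}^\infty|P(X\le t)-P(Y\le t)|\,dt$ is the $L^1$ (Wasserstein-1) distance. *)

theory Defs
  imports "HOL-Probability.Probability"
begin

datatype color = White | Black

definition urn_contents :: "nat \<Rightarrow> nat \<Rightarrow> nat \<Rightarrow> color list \<Rightarrow> color multiset" where
  "urn_contents m A B cs = replicate_mset A White + replicate_mset B Black + repeat_mset m (mset cs)"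

(* Joint distribution of the colors of the first n draws, most recent draw first.
   The library's pmf_of_multiset weighs each color by its multiplicity, i.e. it is the color
   of a ball chosen uniformly at random. *)
primrec polya_draws :: "nat \<Rightarrow> nat \<Rightarrow> nat \<Rightarrow> nat \<Rightarrow> color list pmf" where
  "polya_draws m A B 0 = return_pmf []"
| "polya_draws m A B (Suc n) =
     bind_pmf (polya_draws m A B n) (\<lambda>cs.
       map_pmf (\<lambda>c. c # cs) (pmf_of_multiset (urn_contents m A B cs)))"

definition white_draws :: "color list \<Rightarrow> nat" where
  "white_draws cs = count_list cs White"

(* W_n as a random variable on polya_draws m A B n, where white_draws plays the role of S_n. *)
definition polya_W :: "nat \<Rightarrow> nat \<Rightarrow> nat \<Rightarrow> nat \<Rightarrow> color list \<Rightarrow> real" where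
  "polya_W m A B n cs =
     sqrt ((real A + real B + real m) * real n /
           (real A * real B * (real A + real B + real n * real m))) *
     (real A - (real A + real B) * real (white_draws cs) / real n)"

(* The L^1 distance of two laws on the real line. It is ennreal-valued, so that a finite upper
   bound also asserts that the integral converges. *)
definition L1_dist :: "real measure \<Rightarrow> real measure \<Rightarrow> ennreal" where
  "L1_dist \<mu> \<nu> = (\<integral>\<^sup>+ t. ennreal \<bar>cdf \<mu> t - cdf \<nu> t\<bar> \<partial>lborel)"

end

(* Stein's method. The urn satisfies detailed balance between S = k and S = k + 1, so
   E[W f(W)] = kappa E[lam(S) (f(W) - f(W - delta))] with lam(k) = (n - k)(A + k m) and
   delta = kappa (A + B): the Stein kernel T = kappa delta lam(S) has mean 1 and is explicit in W.
   Being an affine combination of W and W^2 - 1 with small coefficients, T - 1 has an L^1 norm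
   that is controlled by E W = 0 and E W^2 = 1 alone. For a 1-Lipschitz test function the Stein
   equation f' - w f = h - E h(Z) has a solution with |f'| <= 2 and f' Lipschitz with constant 8,
   hence |E h(W) - E h(Z)| <= 2 E|T - 1| + 4 delta, and this single bound implies both claims. *)

theory Submission
  imports Defs "HOL-Real_Asymp.Real_Asymp"
begin

subsection \<open>The $L^1$ distance and Lipschitz test functions\<close>

text \<open>Write D = A + B. Since W falls by delta when S grows by one, the difference in the Stein
  identity is a backward one. A bound on E|T - 1| through its variance would call for fourth
  moments; instead |W| <= (1 + W^2)/2 and |W^2 - 1| <= 1 + W^2 give E|T - 1| <= kappa (D + nm) +
  2m/D. The last term is at most kappa (D + nm), so everything is a multiple of kappa and the total
  is kappa (8 D + 4 nm). A Lipschitz h need not be differentiable, so f'' is never formed: the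
  Taylor remainder uses the Lipschitz constant of f' = h - E h(Z) + w f. That constant is 8 = 1 + 4
  + 3, from h, from |f| <= 4 and from |w f'| <= 3. With n + 1 draws the bound becomes (4mn/(D + m) +
  8) times the square root of the claim. Since (A^2 + B^2)/(AB) >= 2, the 8 is at most the second
  summand of the first claim; where 4mn/(D + m) < 2, the same inequality absorbs that term and gives
  the second claim.\<close>

lemma integral_diff_indicator_lessThan:
  fixes x y :: real
  shows "integrable lborel (\<lambda>t. indicator {..<x} t - indicator {..<y} t :: real)"
    and "(LBINT t. \<bar>indicator {..<x} t - indicator {..<y} t :: real\<bar>) = \<bar>x - y\<bar>"
proof -
  have eq: "(\<lambda>t. indicator {..<x} t - indicator {..<y} t :: real) = (\<lambda>t. indicator {y..<x} t - indicator {x..<y} t)"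
    and abs_eq: "(\<lambda>t. \<bar>indicator {..<x} t - indicator {..<y} t :: real\<bar>) = (\<lambda>t. indicator {y..<x} t + indicator {x..<y} t)"
    by (auto simp: indicator_def fun_eq_iff)
  have fin: "emeasure lborel {u..<v} < top" for u v :: real
    by (cases "u \<le> v") auto
  show "integrable lborel (\<lambda>t. indicator {..<x} t - indicator {..<y} t :: real)"
    unfolding eq by (intro Bochner_Integration.integrable_diff integrable_real_indicator)
      (auto simp: fin)
  show "(LBINT t. \<bar>indicator {..<x} t - indicator {..<y} t :: real\<bar>) = \<bar>x - y\<bar>"
    unfolding abs_eq
    by (subst Bochner_Integration.integral_add; cases "x \<le> y") (auto intro!: integrable_real_indicator simp: fin)
qed

text \<open>The integral is the oriented integral of g from 0 to x. Writing it with a difference of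
  indicators treats both signs of x at once and puts it in the shape that Fubini needs next.\<close>

lemma lipschitz_primitive_bounded:
  fixes g :: "real \<Rightarrow> real"
  assumes [measurable]: "g \<in> borel_measurable borel" and g: "\<And>t. \<bar>g t\<bar> \<le> 1"
  shows "1-lipschitz_on UNIV (\<lambda>x. LBINT t. g t * (indicator {..<x} t - indicator {..<0} t))"
proof (rule lipschitz_onI)
  fix x y :: real
  have int: "integrable lborel (\<lambda>t. g t * (indicator {..<u} t - indicator {..<v} t))" for u v :: real
    by (rule Bochner_Integration.integrable_bound[OF integral_diff_indicator_lessThan(1)[of u v]])
       (auto simp: abs_mult intro!: AE_I2 mult_left_le_one_le g)
  have "(LBINT t. g t * (indicator {..<x} t - indicator {..<0} t)) - (LBINT t. g t * (indicator {..<y} t - indicator {..<0} t))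
      = (LBINT t. g t * (indicator {..<x} t - indicator {..<y} t))"
    by (subst Bochner_Integration.integral_diff[symmetric, OF int int]) (simp add: algebra_simps)
  also have "\<bar>\<dots>\<bar> \<le> (LBINT t. \<bar>g t * (indicator {..<x} t - indicator {..<y} t)\<bar>)"
    by (rule integral_abs_bound)
  also have "\<dots> \<le> (LBINT t. \<bar>indicator {..<x} t - indicator {..<y} t :: real\<bar>)"
    by (rule integral_mono[OF integrable_abs[OF int] integrable_abs[OF integral_diff_indicator_lessThan(1)]])
       (auto simp: abs_mult intro!: mult_left_le_one_le g)
  finally show "dist (LBINT t. g t * (indicator {..<x} t - indicator {..<0} t))
      (LBINT t. g t * (indicator {..<y} t - indicator {..<0} t)) \<le> 1 * dist x y"
    by (simp add: dist_real_def integral_diff_indicator_lessThan(2))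
qed simp

text \<open>Fubini: averaging the indicator of t < x over x gives the upper tail 1 - cdf.
  Subtracting the indicator of t < 0 makes this tail integrable on the negative half-line. The inner
  integral of the absolute kernel is at most |x|, so a finite first moment justifies the
  exchange.\<close>

lemma (in real_distribution) integral_kernel_eq_cdf:
  fixes g :: "real \<Rightarrow> real"
  assumes g_meas [measurable]: "g \<in> borel_measurable borel" and g: "\<And>t. \<bar>g t\<bar> \<le> 1"
    and int: "integrable M (\<lambda>x. x)"
  shows "integrable lborel (\<lambda>t. g t * (1 - cdf M t - indicator {..<0} t))"
    and "(LINT x|M. (LBINT t. g t * (indicator {..<x} t - indicator {..<0} t))) =
      (LBINT t. g t * (1 - cdf M t - indicator {..<0} t))"
proof -
  interpret pair_sigma_finite M lborel ..
  let ?k = "\<lambda>x t. g t * (indicator {..<x} t - indicator {..<0} t)"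
  have kint: "integrable lborel (?k x)" for x
    by (rule Bochner_Integration.integrable_bound[OF integral_diff_indicator_lessThan(1)[of x 0]])
       (auto simp: abs_mult intro!: AE_I2 mult_left_le_one_le g)
  have "(\<lambda>z. ?k (fst z) (snd z)) \<in> borel_measurable (borel \<Otimes>\<^sub>M borel)"
  proof -
    \<comment> \<open>The set \<open>{..<x}\<close> varies with the first coordinate, so joint
      measurability is checked on the comparison t < x itself.\<close>
    have "(\<lambda>z::real \<times> real. g (snd z) * ((if snd z < fst z then 1 else 0) - (if snd z < 0 then 1 else 0))) \<in> borel_measurable (borel \<Otimes>\<^sub>M borel)"
      by measurable
    then show ?thesis by (simp add: indicator_def of_bool_def)
  qed
  then have meas: "(\<lambda>(x, t). ?k x t) \<in> borel_measurable (M \<Otimes>\<^sub>M lborel)"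
    by (simp add: case_prod_beta cong: measurable_cong_sets sets_pair_measure_cong)
  have "integrable M (\<lambda>x. LBINT t. norm (?k x t))"
  proof (rule Bochner_Integration.integrable_bound[OF int])
    show "(\<lambda>x. LBINT t. norm (?k x t)) \<in> borel_measurable M"
      using meas by (intro lborel.borel_measurable_lebesgue_integral) (simp add: case_prod_beta)
    have "norm (LBINT t. norm (?k x t)) \<le> norm x" for x
    proof -
      have "(LBINT t. norm (?k x t)) \<le> (LBINT t. \<bar>indicator {..<x} t - indicator {..<0} t :: real\<bar>)"
        using integrable_abs[OF kint] integrable_abs[OF integral_diff_indicator_lessThan(1)]
        by (intro integral_mono) (auto simp: abs_mult intro!: mult_left_le_one_le g)
      then show ?thesis
        by (simp add: integral_diff_indicator_lessThan(2))
    qed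
    then show "AE x in M. norm (LBINT t. norm (?k x t)) \<le> norm x" by simp
  qed
  then have I: "integrable (M \<Otimes>\<^sub>M lborel) (\<lambda>(x, t). ?k x t)"
    using meas kint by (intro Fubini_integrable) auto
  have inner: "(LINT x|M. ?k x t) = g t * (1 - cdf M t - indicator {..<0} t)" for t
  proof -
    have "indicator {..<x} t = (indicator {t<..} x :: real)" for x
      by (auto simp: indicator_def)
    then have "(LINT x|M. ?k x t) = g t * (LINT x|M. indicator {t<..} x - indicator {..<0} t)"
      by simp
    also have "(LINT x|M. indicator {t<..} x - indicator {..<0} t :: real) = prob {t<..} - indicator {..<0} t"
      using prob_space
      by (subst Bochner_Integration.integral_diff)
         (auto simp: emeasure_eq_measure intro!: integrable_real_indicator)
    also have "prob {t<..} = 1 - cdf M t"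
      using prob_compl[of "{..t}"] by (simp add: cdf_def2 Compl_eq_Diff_UNIV[symmetric] Compl_atMost)
    finally show ?thesis .
  qed
  show "integrable lborel (\<lambda>t. g t * (1 - cdf M t - indicator {..<0} t))"
    using integrable_snd[OF I] unfolding inner .
  show "(LINT x|M. (LBINT t. ?k x t)) = (LBINT t. g t * (1 - cdf M t - indicator {..<0} t))"
    using Fubini_integral[OF I] unfolding inner by (rule sym)
qed

(* The optimal test function is the primitive of the sign of the difference of the two cdfs. *)
lemma L1_dist_le_lipschitz:
  assumes "real_distribution \<mu>" "real_distribution \<nu>"
    and "integrable \<mu> (\<lambda>x. x)" "integrable \<nu> (\<lambda>x. x)"
    and le: "\<And>h. 1-lipschitz_on UNIV h \<Longrightarrow> (LINT x|\<mu>. h x) - (LINT x|\<nu>. h x) \<le> C"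
  shows "L1_dist \<mu> \<nu> \<le> ennreal C"
proof -
  interpret \<mu>: real_distribution \<mu> by fact
  interpret \<nu>: real_distribution \<nu> by fact
  define g where "g t = sgn (cdf \<nu> t - cdf \<mu> t)" for t
  have [measurable]: "cdf \<mu> \<in> borel_measurable borel" "cdf \<nu> \<in> borel_measurable borel"
    by (auto intro!: borel_measurable_mono monoI \<mu>.cdf_nondecreasing \<nu>.cdf_nondecreasing)
  have g_meas [measurable]: "g \<in> borel_measurable borel"
    unfolding g_def by measurable
  have g: "\<bar>g t\<bar> \<le> 1" for t by (simp add: g_def abs_sgn_eq)
  note \<mu> = \<mu>.integral_kernel_eq_cdf[OF g_meas g assms(3)]
  note \<nu> = \<nu>.integral_kernel_eq_cdf[OF g_meas g assms(4)]
  \<comment> \<open>The terms free of the cdfs cancel. The kernel contains \<open>- cdf\<close>,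
    which is why the sign in \<open>g\<close> is that of
    \<open>cdf \<nu> t - cdf \<mu> t\<close>.\<close>
  have eq: "g t * (1 - cdf \<mu> t - indicator {..<0} t) - g t * (1 - cdf \<nu> t - indicator {..<0} t)
      = \<bar>cdf \<mu> t - cdf \<nu> t\<bar>" for t
    by (simp add: g_def sgn_if algebra_simps)
  have int: "integrable lborel (\<lambda>t. \<bar>cdf \<mu> t - cdf \<nu> t\<bar>)"
    using Bochner_Integration.integrable_diff[OF \<mu>(1) \<nu>(1)] by (simp only: eq)
  have "(LBINT t. \<bar>cdf \<mu> t - cdf \<nu> t\<bar>) =
      (LINT x|\<mu>. (LBINT t. g t * (indicator {..<x} t - indicator {..<0} t)))
      - (LINT x|\<nu>. (LBINT t. g t * (indicator {..<x} t - indicator {..<0} t)))"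
    unfolding \<mu>(2) \<nu>(2) Bochner_Integration.integral_diff[OF \<mu>(1) \<nu>(1), symmetric] eq ..
  also have "\<dots> \<le> C"
    by (intro le lipschitz_primitive_bounded g_meas g)
  finally show ?thesis
    unfolding L1_dist_def by (subst nn_integral_eq_integral[OF int]) (auto intro: ennreal_leI)
qed

subsection \<open>Tails of the standard normal density\<close>

lemma set_integrable_lborelI:
  fixes f :: "real \<Rightarrow> real"
  assumes "integrable lborel f" "S \<in> sets borel"
  shows "set_integrable lborel S f"
  using assms integrable_mult_indicator[of S lborel f] by (simp add: set_integrable_def)

lemma set_integral_FTC_atLeast:
  fixes f F :: "real \<Rightarrow> real"
  assumes F: "\<And>x. (F has_real_derivative f x) (at x)"
    and f: "continuous_on UNIV f" and int: "set_integrable lborel {a..} f"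
    and lim: "(F \<longlongrightarrow> T) at_top"
  shows "(LBINT x:{a..}. f x) = T - F a"
proof (rule tendsto_unique[OF trivial_limit_at_top_linorder])
  show "((\<lambda>b. LBINT x:{a..b}. f x) \<longlongrightarrow> (LBINT x:{a..}. f x)) at_top"
    by (rule tendsto_set_lebesgue_integral_at_top[OF _ int]) simp
  have "((\<lambda>b. F b - F a) \<longlongrightarrow> T - F a) at_top"
    by (intro tendsto_intros lim)
  moreover have "\<forall>\<^sub>F b in at_top. F b - F a = (LBINT x:{a..b}. f x)"
    using eventually_ge_at_top[of a]
  proof eventually_elim
    case (elim b)
    have "(LBINT x:{a..b}. f x) = F b - F a"
      unfolding set_lebesgue_integral_def
    proof (rule integral_FTC_atLeastAtMost[OF elim])
      show "continuous_on {a..b} f" using f by (rule continuous_on_subset) simp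
      show "(F has_vector_derivative f x) (at x within {a..b})" for x
        by (rule has_vector_derivative_at_within)
          (rule F[unfolded has_real_derivative_iff_has_vector_derivative])
    qed
    then show ?case by simp
  qed
  ultimately show "((\<lambda>b. LBINT x:{a..b}. f x) \<longlongrightarrow> T - F a) at_top"
    by (rule Lim_transform_eventually)
qed

lemma DERIV_set_integral_atLeast:
  fixes f :: "real \<Rightarrow> real"
  assumes f: "continuous_on UNIV f" and int: "integrable lborel f"
  shows "((\<lambda>w. LBINT x:{w..}. f x) has_real_derivative - f w) (at w)"
proof -
  note si = set_integrable_lborelI[OF int]
  \<comment> \<open>Cutting the half-line at the fixed point w + 1 leaves only a compact integral
    depending on u, to which the fundamental theorem applies at the interior point w.\<close>
  have split: "(LBINT x:{u..}. f x) = (LBINT x:{w + 1..}. f x) + integral {u..w + 1} f" if "u < w + 1" for u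
  proof -
    have "{u..} = {u..<w + 1} \<union> {w + 1..}" using that by auto
    then have "(LBINT x:{u..}. f x) = (LBINT x:{u..<w + 1}. f x) + (LBINT x:{w + 1..}. f x)"
      by (simp only:) (rule set_integral_Un; auto intro!: si)
    also have "(LBINT x:{u..<w + 1}. f x) = integral {u..<w + 1} f"
      by (rule set_borel_integral_eq_integral) (auto intro!: si)
    also have "\<dots> = integral {u..w + 1} f"
      by (rule integral_subset_negligible) (auto intro: negligible_subset[of "{w + 1}"])
    finally show ?thesis by simp
  qed
  have "((\<lambda>u. integral {u..w + 1} f) has_real_derivative - f w) (at w within {w - 1..w + 1})"
    by (rule integral_has_real_derivative') (use f in \<open>auto intro: continuous_on_subset\<close>)
  then have "((\<lambda>u. (LBINT x:{w + 1..}. f x) + integral {u..w + 1} f) has_real_derivative - f w) (at w)"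
    by (subst (asm) at_within_Icc_at) (auto intro!: derivative_eq_intros)
  moreover have "\<forall>\<^sub>F u in nhds w. (LBINT x:{u..}. f x) = (LBINT x:{w + 1..}. f x) + integral {u..w + 1} f"
  proof -
    have "\<forall>\<^sub>F u in nhds w. u \<in> {..<w + 1}"
      by (rule eventually_nhds_in_open) auto
    then show ?thesis by eventually_elim (auto intro: split)
  qed
  ultimately show ?thesis
    by (rule DERIV_cong_ev[OF refl _ refl, THEN iffD2, rotated])
qed

section \<open>Moments, tail integrals and Mills ratio bounds\<close>

lemma std_normal_density_pos: "std_normal_density x > 0"
  by (simp add: normal_density_pos)

lemma std_normal_density_uminus [simp]: "std_normal_density (- x) = std_normal_density x"
  by (simp add: std_normal_density_def)

lemma DERIV_std_normal_density:
  "(std_normal_density has_real_derivative - x * std_normal_density x) (at x)"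
  unfolding std_normal_density_def[abs_def]
  by (auto intro!: derivative_eq_intros simp: field_simps)

lemma continuous_on_std_normal_density [continuous_intros]:
  "continuous_on S g \<Longrightarrow> continuous_on S (\<lambda>x. std_normal_density (g x))"
  unfolding std_normal_density_def by (intro continuous_intros) auto

lemma integrable_std_normal_abs: "integrable lborel (\<lambda>x. std_normal_density x * \<bar>x\<bar>)"
  using integrable_std_normal_moment_abs[of 1] by simp

lemma integrable_std_normal_id: "integrable lborel (\<lambda>x. std_normal_density x * x)"
  using integrable_std_normal_moment[of 1] by simp

lemma integrable_std_normal_square: "integrable lborel (\<lambda>x. std_normal_density x * x\<^sup>2)"
  by (rule integrable_std_normal_moment)

lemma integral_std_normal_square: "(LBINT x. std_normal_density x * x\<^sup>2) = 1"
  using integral_std_normal_moment_even[of 1] by (simp add: fact_numeral)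

lemma integral_std_normal_abs_le: "(LBINT x. std_normal_density x * \<bar>x\<bar>) \<le> 1"
proof -
  have "(LBINT x. std_normal_density x * \<bar>x\<bar>)
      \<le> (LBINT x. std_normal_density x / 2 + std_normal_density x * x\<^sup>2 / 2)"
  proof (rule integral_mono)
    fix x :: real
    have "\<bar>x\<bar> \<le> 1 / 2 + x\<^sup>2 / 2"
      using sum_squares_bound[of 1 "\<bar>x\<bar>"] by simp
    then have "std_normal_density x * \<bar>x\<bar> \<le> std_normal_density x * (1 / 2 + x\<^sup>2 / 2)"
      by (rule mult_left_mono) simp
    then show "std_normal_density x * \<bar>x\<bar> \<le> std_normal_density x / 2 + std_normal_density x * x\<^sup>2 / 2"
      by (simp add: ring_distribs)
  qed (simp_all add: integrable_std_normal_abs integrable_std_normal_square)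
  also have "\<dots> = 1"
    by (subst Bochner_Integration.integral_add)
       (auto simp: integrable_std_normal_square integral_std_normal_square)
  finally show ?thesis .
qed

lemma tendsto_std_normal_density_at_top:
  "((\<lambda>x. std_normal_density x) \<longlongrightarrow> 0) at_top" "((\<lambda>x. std_normal_density x * x) \<longlongrightarrow> 0) at_top"
proof -
  have "((\<lambda>x::real. exp (- x\<^sup>2 / 2)) \<longlongrightarrow> 0) at_top" "((\<lambda>x::real. exp (- x\<^sup>2 / 2) * x) \<longlongrightarrow> 0) at_top"
    by real_asymp+
  from this[THEN tendsto_mult_right_zero, of "1 / sqrt (2 * pi)"]
  show "((\<lambda>x. std_normal_density x) \<longlongrightarrow> 0) at_top" "((\<lambda>x. std_normal_density x * x) \<longlongrightarrow> 0) at_top"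
    by (simp_all add: std_normal_density_def mult.assoc)
qed

definition std_normal_tail :: "real \<Rightarrow> real" where
  "std_normal_tail w = (LBINT x:{w..}. std_normal_density x)"

lemma std_normal_tail_id:
  "(LBINT x:{w..}. std_normal_density x * x) = std_normal_density w"
proof -
  have "(LBINT x:{w..}. std_normal_density x * x) = - 0 - - std_normal_density w"
  proof (rule set_integral_FTC_atLeast)
    show "((\<lambda>x. - std_normal_density x) has_real_derivative std_normal_density x * x) (at x)" for x
      using DERIV_minus[OF DERIV_std_normal_density[of x]] by (simp add: mult.commute)
    show "((\<lambda>x. - std_normal_density x) \<longlongrightarrow> - 0) at_top"
      by (rule tendsto_minus) (rule tendsto_std_normal_density_at_top)
    show "continuous_on UNIV (\<lambda>x. std_normal_density x * x)"
      by (intro continuous_intros)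
    show "set_integrable lborel {w..} (\<lambda>x. std_normal_density x * x)"
      by (rule set_integrable_lborelI[OF integrable_std_normal_id]) simp
  qed
  then show ?thesis by simp
qed

lemma std_normal_tail_square:
  "(LBINT x:{w..}. std_normal_density x * x\<^sup>2) = std_normal_tail w + std_normal_density w * w"
proof -
  have i: "set_integrable lborel {w..} (\<lambda>x. std_normal_density x * x\<^sup>2)" "set_integrable lborel {w..} std_normal_density"
    by (auto intro!: set_integrable_lborelI integrable_std_normal_square)
  have "(LBINT x:{w..}. std_normal_density x * x\<^sup>2 - std_normal_density x) = - 0 - - (std_normal_density w * w)"
  proof (rule set_integral_FTC_atLeast)
    show "((\<lambda>x. - (std_normal_density x * x)) has_real_derivative std_normal_density x * x\<^sup>2 - std_normal_density x) (at x)" for x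
      by (auto intro!: derivative_eq_intros DERIV_std_normal_density simp: power2_eq_square algebra_simps)
    show "((\<lambda>x. - (std_normal_density x * x)) \<longlongrightarrow> - 0) at_top"
      by (rule tendsto_minus) (rule tendsto_std_normal_density_at_top)
    show "continuous_on UNIV (\<lambda>x. std_normal_density x * x\<^sup>2 - std_normal_density x)"
      by (intro continuous_intros)
    show "set_integrable lborel {w..} (\<lambda>x. std_normal_density x * x\<^sup>2 - std_normal_density x)"
      by (rule set_integral_diff) (rule i)+
  qed
  moreover have "(LBINT x:{w..}. std_normal_density x * x\<^sup>2 - std_normal_density x) =
      (LBINT x:{w..}. std_normal_density x * x\<^sup>2) - std_normal_tail w"
    unfolding std_normal_tail_def by (rule set_integral_diff) (rule i)+
  ultimately show ?thesis by simp
qed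

lemma std_normal_tail_nonneg: "0 \<le> std_normal_tail w"
  unfolding std_normal_tail_def set_lebesgue_integral_def
  by (rule Bochner_Integration.integral_nonneg) (simp add: indicator_def)

text \<open>This is the mean of the positive part of Z - w. It bounds the integral over the tail of
  the increments h x - h w of a 1-Lipschitz h.\<close>

lemma std_normal_tail_shift:
  "(LBINT x:{w..}. std_normal_density x * (x - w)) = std_normal_density w - w * std_normal_tail w"
proof -
  have i: "set_integrable lborel {w..} (\<lambda>x. std_normal_density x * x)" "set_integrable lborel {w..} (\<lambda>x. std_normal_density x * w)"
    by (auto intro!: set_integrable_lborelI integrable_std_normal_id)
  have "(LBINT x:{w..}. std_normal_density x * (x - w)) = (LBINT x:{w..}. std_normal_density x * x - std_normal_density x * w)"
    by (simp add: right_diff_distrib)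
  also have "\<dots> = std_normal_density w - std_normal_tail w * w"
    using i by (simp only: set_integral_diff set_integral_mult_left std_normal_tail_id std_normal_tail_def[symmetric])
  finally show ?thesis by (simp add: mult.commute)
qed

text \<open>The lower Mills ratio bound, obtained by expanding the nonnegative tail integral of (x -
  w)^2. For w >= 0 it yields the decay of
  \<open>std_normal_density w - w * std_normal_tail w\<close> by a factor 1 + w^2 that the bound on
  f' rests on.\<close>

lemma std_normal_tail_lower: "w * std_normal_density w \<le> (1 + w\<^sup>2) * std_normal_tail w"
proof -
  have i: "set_integrable lborel {w..} (\<lambda>x. std_normal_density x * x\<^sup>2)"
    "set_integrable lborel {w..} (\<lambda>x. std_normal_density x * x * (2 * w))"
    "set_integrable lborel {w..} (\<lambda>x. std_normal_density x * w\<^sup>2)"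
    by (rule set_integrable_lborelI; simp add: integrable_std_normal_id integrable_std_normal_square)+
  have "0 \<le> (LBINT x:{w..}. std_normal_density x * (x - w)\<^sup>2)"
    unfolding set_lebesgue_integral_def by (rule Bochner_Integration.integral_nonneg) (simp add: indicator_def)
  also have "(LBINT x:{w..}. std_normal_density x * (x - w)\<^sup>2) =
     (LBINT x:{w..}. std_normal_density x * x\<^sup>2 - std_normal_density x * x * (2 * w) + std_normal_density x * w\<^sup>2)"
    by (simp add: power2_diff algebra_simps)
  also have "\<dots> = (LBINT x:{w..}. std_normal_density x * x\<^sup>2) - (LBINT x:{w..}. std_normal_density x * x * (2 * w))
      + (LBINT x:{w..}. std_normal_density x * w\<^sup>2)"
    using i by (simp only: set_integral_add set_integral_diff)
  also have "\<dots> = (1 + w\<^sup>2) * std_normal_tail w - w * std_normal_density w"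
    unfolding set_integral_mult_left std_normal_tail_square std_normal_tail_id std_normal_tail_def[symmetric]
    by (simp add: algebra_simps power2_eq_square)
  finally show ?thesis by simp
qed

text \<open>For x >= w >= 0 one has x^2 >= w^2 + (x - w)^2, so the density at x is at most
  \<open>sqrt (2 * pi)\<close> times the product of the densities at w and x - w. Integrating the
  shifted density over the whole line gives 1.\<close>

lemma std_normal_tail_upper:
  assumes "w \<ge> 0"
  shows "std_normal_tail w \<le> sqrt (2 * pi) * std_normal_density w"
proof -
  let ?g = "\<lambda>x. sqrt (2 * pi) * std_normal_density w * std_normal_density (x - w)"
  have shift: "integrable lborel (\<lambda>x. std_normal_density (x - w))" "(LBINT x. std_normal_density (x - w)) = 1"
    using lborel_integrable_real_affine[of "std_normal_density" 1 "- w"]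
      lborel_integral_real_affine[of 1 "std_normal_density" "- w"] by (simp_all)
  have "std_normal_tail w \<le> (LBINT x. ?g x)"
    unfolding std_normal_tail_def set_lebesgue_integral_def
  proof (rule integral_mono)
    show "integrable lborel (\<lambda>x. indicator {w..} x *\<^sub>R std_normal_density x)"
      using set_integrable_lborelI[of std_normal_density "{w..}"] by (simp add: set_integrable_def)
    show "integrable lborel ?g"
      using shift by simp
    fix x
    have "std_normal_density x \<le> ?g x" if "x \<ge> w"
    proof -
      have "0 \<le> w * (x - w)" using assms that by simp
      then have "- x\<^sup>2 / 2 \<le> - w\<^sup>2 / 2 + - (x - w)\<^sup>2 / 2"
        by (simp add: power2_eq_square algebra_simps)
      then have "exp (- x\<^sup>2 / 2) \<le> exp (- w\<^sup>2 / 2) * exp (- (x - w)\<^sup>2 / 2)"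
        by (simp flip: exp_add)
      then show ?thesis
        by (simp add: std_normal_density_def divide_right_mono)
    qed
    then show "indicator {w..} x *\<^sub>R std_normal_density x \<le> ?g x"
      by (simp add: indicator_def)
  qed
  also have "\<dots> = sqrt (2 * pi) * std_normal_density w"
    using shift by simp
  finally show ?thesis .
qed

subsection \<open>The Stein equation\<close>

definition std_normal_mean :: "(real \<Rightarrow> real) \<Rightarrow> real" where
  "std_normal_mean h = (LBINT x. std_normal_density x * h x)"

text \<open>For a solution f of f' - w f = h - E h(Z), the product of f with the normal density has
  derivative density times (h - E h(Z)). The constant of integration is chosen so that this product
  vanishes at plus infinity, which keeps f bounded.\<close>

definition stein_solution :: "(real \<Rightarrow> real) \<Rightarrow> real \<Rightarrow> real" where
  "stein_solution h w = - (LBINT x:{w..}. std_normal_density x * (h x - std_normal_mean h)) / std_normal_density w"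

text \<open>Read off from the Stein equation, so that the equation holds by definition;
  \<open>DERIV_stein_solution\<close> shows that this is the derivative.\<close>

definition stein_solution_deriv :: "(real \<Rightarrow> real) \<Rightarrow> real \<Rightarrow> real" where
  "stein_solution_deriv h w = h w - std_normal_mean h + w * stein_solution h w"

section \<open>Lipschitz functions under the standard normal law\<close>

lemma lipschitz_1_realD: "1-lipschitz_on UNIV h \<Longrightarrow> \<bar>h x - h y\<bar> \<le> \<bar>x - y\<bar>" for h :: "real \<Rightarrow> real"
  using lipschitz_onD[of 1 UNIV h x y] by (simp add: dist_real_def)

lemma lipschitz_1_continuous: "1-lipschitz_on UNIV h \<Longrightarrow> continuous_on UNIV h" for h :: "real \<Rightarrow> real"
  by (rule lipschitz_on_continuous_on)

lemma lipschitz_1_borel: "1-lipschitz_on UNIV h \<Longrightarrow> h \<in> borel_measurable borel" for h :: "real \<Rightarrow> real"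
  by (rule borel_measurable_continuous_onI) (rule lipschitz_1_continuous)

lemma integrable_std_normal_lipschitz:
  fixes h :: "real \<Rightarrow> real"
  assumes "1-lipschitz_on UNIV h"
  shows "integrable lborel (\<lambda>x. std_normal_density x * h x)"
proof (rule Bochner_Integration.integrable_bound)
  show "integrable lborel (\<lambda>x. std_normal_density x * \<bar>h 0\<bar> + std_normal_density x * \<bar>x\<bar>)"
    by (simp add: integrable_std_normal_abs)
  show "(\<lambda>x. std_normal_density x * h x) \<in> borel_measurable lborel"
    using lipschitz_1_borel[OF assms] by simp
  have "norm (std_normal_density x * h x) \<le> norm (std_normal_density x * \<bar>h 0\<bar> + std_normal_density x * \<bar>x\<bar>)" for x
  proof -
    have "\<bar>h x\<bar> \<le> \<bar>h 0\<bar> + \<bar>x\<bar>"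
      using lipschitz_1_realD[OF assms, of x 0] by simp
    then have "std_normal_density x * \<bar>h x\<bar> \<le> std_normal_density x * (\<bar>h 0\<bar> + \<bar>x\<bar>)"
      by (rule mult_left_mono) simp
    then show ?thesis by (simp add: abs_mult ring_distribs)
  qed
  then show "AE x in lborel. norm (std_normal_density x * h x) \<le> norm (std_normal_density x * \<bar>h 0\<bar> + std_normal_density x * \<bar>x\<bar>)"
    by simp
qed

lemma integrable_std_normal_centered:
  fixes h :: "real \<Rightarrow> real"
  assumes "1-lipschitz_on UNIV h"
  shows "integrable lborel (\<lambda>x. std_normal_density x * (h x - c))"
  using integrable_std_normal_lipschitz[OF assms] by (simp add: right_diff_distrib)

lemma abs_diff_std_normal_mean_le:
  fixes h :: "real \<Rightarrow> real"
  assumes "1-lipschitz_on UNIV h"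
  shows "\<bar>h w - std_normal_mean h\<bar> \<le> \<bar>w\<bar> + 1"
proof -
  have "std_normal_mean h - h w = (LBINT x. std_normal_density x * (h x - h w))"
    using integrable_std_normal_lipschitz[OF assms]
    by (simp add: right_diff_distrib std_normal_mean_def)
  also have "\<bar>\<dots>\<bar> \<le> (LBINT x. \<bar>std_normal_density x * (h x - h w)\<bar>)"
    by (rule integral_abs_bound)
  also have "\<dots> \<le> (LBINT x. std_normal_density x * \<bar>w\<bar> + std_normal_density x * \<bar>x\<bar>)"
  proof (rule integral_mono)
    show "integrable lborel (\<lambda>x. \<bar>std_normal_density x * (h x - h w)\<bar>)"
      by (rule integrable_abs) (rule integrable_std_normal_centered[OF assms])
    show "integrable lborel (\<lambda>x. std_normal_density x * \<bar>w\<bar> + std_normal_density x * \<bar>x\<bar>)"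
      by (simp add: integrable_std_normal_abs)
    fix x
    have "\<bar>h x - h w\<bar> \<le> \<bar>w\<bar> + \<bar>x\<bar>"
      using lipschitz_1_realD[OF assms, of x w] by linarith
    then have "std_normal_density x * \<bar>h x - h w\<bar> \<le> std_normal_density x * (\<bar>w\<bar> + \<bar>x\<bar>)"
      by (rule mult_left_mono) simp
    then show "\<bar>std_normal_density x * (h x - h w)\<bar> \<le> std_normal_density x * \<bar>w\<bar> + std_normal_density x * \<bar>x\<bar>"
      by (simp only: abs_mult abs_of_nonneg[OF normal_density_nonneg] distrib_left)
  qed
  also have "\<dots> = \<bar>w\<bar> + (LBINT x. std_normal_density x * \<bar>x\<bar>)"
    by (simp add: integrable_std_normal_abs)
  also have "\<dots> \<le> \<bar>w\<bar> + 1" using integral_std_normal_abs_le by simp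
  finally show ?thesis by (simp add: abs_minus_commute)
qed

section \<open>Size and regularity of the Stein solution\<close>

lemma DERIV_stein_solution:
  assumes "1-lipschitz_on UNIV h"
  shows "(stein_solution h has_real_derivative stein_solution_deriv h w) (at w)"
proof -
  let ?p = std_normal_density and ?q = "\<lambda>x. std_normal_density x * (h x - std_normal_mean h)"
  let ?G = "\<lambda>w. LBINT x:{w..}. ?q x"
  have G: "(?G has_real_derivative - ?q w) (at w)"
    by (rule DERIV_set_integral_atLeast)
       (auto intro!: continuous_intros lipschitz_1_continuous[OF assms] integrable_std_normal_centered[OF assms])
  have p: "?p w \<noteq> 0" using std_normal_density_pos[of w] by simp
  have "((\<lambda>w. - ?G w / ?p w) has_real_derivative (- (- ?q w) * ?p w - - ?G w * (- w * ?p w)) / (?p w * ?p w)) (at w)"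
    by (rule DERIV_divide[OF DERIV_minus[OF G] DERIV_std_normal_density p])
  moreover have "(- (- ?q w) * ?p w - - ?G w * (- w * ?p w)) / (?p w * ?p w) = stein_solution_deriv h w"
    using p by (simp add: stein_solution_deriv_def stein_solution_def field_simps)
  ultimately show ?thesis
    by (simp add: stein_solution_def[abs_def])
qed

text \<open>On the tail, h - E h(Z) splits into the increment h x - h w and the constant c = h w - E
  h(Z), so the tail integral is G = J + R c. In f' the growing contributions cancel and both
  surviving terms carry the factor p - w R, which is at most p / (1 + w^2) by the Mills bound. The
  weight 1 + w^2 is kept because w f' has to be bounded too.\<close>

lemma stein_solution_bounds_nonneg:
  assumes h: "1-lipschitz_on UNIV h" and w: "w \<ge> 0"
  shows "\<bar>stein_solution h w\<bar> \<le> 4" "\<bar>stein_solution_deriv h w\<bar> * (1 + w\<^sup>2) \<le> 2 * w + 1"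
proof -
  define p R G J c where "p = std_normal_density w" "R = std_normal_tail w"
    "G = (LBINT x:{w..}. std_normal_density x * (h x - std_normal_mean h))"
    "J = (LBINT x:{w..}. std_normal_density x * (h x - h w))" "c = h w - std_normal_mean h"
  note defs = this
  have p: "p > 0" using std_normal_density_pos by (simp add: defs)
  have R: "R \<ge> 0" using std_normal_tail_nonneg by (simp add: defs)
  have c: "\<bar>c\<bar> \<le> w + 1" using abs_diff_std_normal_mean_le[OF h, of w] w by (simp add: defs)
  have f: "stein_solution h w * p = - G"
    using p by (simp add: stein_solution_def defs)
  have i: "set_integrable lborel {w..} (\<lambda>x. std_normal_density x * (h x - h w))"
    "set_integrable lborel {w..} (\<lambda>x. std_normal_density x * c)"
    by (rule set_integrable_lborelI; simp add: integrable_std_normal_centered[OF h])+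
  have "G = (LBINT x:{w..}. std_normal_density x * (h x - h w) + std_normal_density x * c)"
    unfolding defs by (simp add: distrib_left[symmetric])
  also have "\<dots> = J + R * c"
    using i by (simp add: set_integral_add defs std_normal_tail_def)
  finally have G: "G = J + R * c" .
  have "\<bar>J\<bar> \<le> (LBINT x:{w..}. std_normal_density x * (x - w))"
    unfolding defs set_lebesgue_integral_def
  proof (rule integral_abs_bound_integral)
    show "integrable lborel (\<lambda>x. indicat_real {w..} x *\<^sub>R (std_normal_density x * (h x - h w)))"
      using i(1) by (simp add: set_integrable_def)
    have "integrable lborel (\<lambda>x. std_normal_density x * (x - w))"
      by (simp add: right_diff_distrib integrable_std_normal_id)
    then show "integrable lborel (\<lambda>x. indicat_real {w..} x *\<^sub>R (std_normal_density x * (x - w)))"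
      using set_integrable_lborelI[of "\<lambda>x. std_normal_density x * (x - w)" "{w..}"]
      by (simp add: set_integrable_def)
    show "\<bar>indicat_real {w..} x *\<^sub>R (std_normal_density x * (h x - h w))\<bar>
        \<le> indicat_real {w..} x *\<^sub>R (std_normal_density x * (x - w))" for x
      using lipschitz_1_realD[OF h, of x w]
      by (auto simp: indicator_def abs_mult intro!: mult_left_mono)
  qed
  then have J: "\<bar>J\<bar> \<le> p - w * R"
    unfolding std_normal_tail_shift by (simp add: defs)
  have cR: "\<bar>R * c\<bar> \<le> R * (w + 1)"
    unfolding abs_mult using R c by (intro mult_mono) auto
  \<comment> \<open>The bounds p - w R for J and (w + 1) R for R c add up to p + R: the terms with w
    cancel.\<close>
  have "\<bar>G\<bar> \<le> R + p"
    unfolding G using J cR by (simp add: algebra_simps)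
  also have "R + p \<le> 4 * p"
  proof -
    have "sqrt (2 * pi) \<le> 3"
      using pi_less_4 by (intro real_le_lsqrt) auto
    then have "sqrt (2 * pi) * p \<le> 3 * p" using p by (intro mult_right_mono) auto
    then show ?thesis using std_normal_tail_upper[OF w] by (simp add: defs)
  qed
  finally have "\<bar>stein_solution h w\<bar> * p \<le> 4 * p"
    using f p by (metis abs_minus_cancel abs_mult abs_of_pos)
  then show "\<bar>stein_solution h w\<bar> \<le> 4" using p by simp
  have pR: "(1 + w\<^sup>2) * (p - w * R) \<le> p"
  proof -
    have "w * (w * p) \<le> w * ((1 + w\<^sup>2) * R)"
      using std_normal_tail_lower[of w] w by (intro mult_left_mono) (auto simp: defs)
    then show ?thesis by (simp add: algebra_simps power2_eq_square)
  qed
  have pR0: "0 \<le> p - w * R" using J by linarith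
  have "stein_solution_deriv h w * p = c * p + w * (stein_solution h w * p)"
    by (simp add: stein_solution_deriv_def defs algebra_simps)
  \<comment> \<open>The part R c of G, multiplied by w, is what reduces c p to c (p - w R).\<close>
  also have "\<dots> = c * (p - w * R) - w * J"
    unfolding f G by (simp add: algebra_simps)
  finally have f': "stein_solution_deriv h w * p = c * (p - w * R) - w * J" .
  have "\<bar>stein_solution_deriv h w\<bar> * p = \<bar>c * (p - w * R) - w * J\<bar>"
    using f' p by (metis abs_mult abs_of_pos)
  also have "\<dots> \<le> \<bar>c\<bar> * (p - w * R) + w * \<bar>J\<bar>"
    using abs_triangle_ineq4[of "c * (p - w * R)" "w * J"] pR0 w by (simp add: abs_mult)
  also have "\<dots> \<le> (w + 1) * (p - w * R) + w * (p - w * R)"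
    using c J pR0 w by (intro add_mono mult_mono) auto
  finally have "\<bar>stein_solution_deriv h w\<bar> * p * (1 + w\<^sup>2) \<le> (2 * w + 1) * (p - w * R) * (1 + w\<^sup>2)"
    by (intro mult_right_mono) (auto simp: algebra_simps)
  also have "\<dots> = (2 * w + 1) * ((1 + w\<^sup>2) * (p - w * R))" by simp
  also have "\<dots> \<le> (2 * w + 1) * p"
    using pR w by (intro mult_left_mono) auto
  finally have "(\<bar>stein_solution_deriv h w\<bar> * (1 + w\<^sup>2)) * p \<le> (2 * w + 1) * p"
    by (simp add: mult_ac)
  then show "\<bar>stein_solution_deriv h w\<bar> * (1 + w\<^sup>2) \<le> 2 * w + 1" using p by simp
qed

lemma std_normal_mean_reflect: "std_normal_mean (\<lambda>x. h (- x)) = std_normal_mean h"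
  using lborel_integral_real_affine[of "-1" "\<lambda>x. std_normal_density x * h x" 0]
  by (simp add: std_normal_mean_def)

text \<open>The centered integrand has total integral 0, so its right tail from -w is minus its left
  tail; reflecting turns the latter into the right tail from w for x \<mapsto> h (- x).\<close>

lemma stein_solution_reflect:
  assumes "1-lipschitz_on UNIV h"
  shows "stein_solution (\<lambda>x. h (- x)) w = - stein_solution h (- w)"
proof -
  let ?q = "\<lambda>x. std_normal_density x * (h x - std_normal_mean h)"
  have int: "integrable lborel ?q" by (rule integrable_std_normal_centered[OF assms])
  have "(LBINT x. ?q x) = 0"
    using integrable_std_normal_lipschitz[OF assms] by (simp add: right_diff_distrib std_normal_mean_def)
  moreover have "(LBINT x:{..- w} \<union> {- w..}. ?q x) = (LBINT x:{..- w}. ?q x) + (LBINT x:{- w..}. ?q x)"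
  proof (rule set_integral_Un_AE)
    show "AE x in lborel. \<not> (x \<in> {..- w} \<and> x \<in> {- w..})"
      using AE_lborel_singleton[of "- w"] by eventually_elim auto
  qed (auto intro: set_integrable_lborelI[OF int])
  moreover have "{..- w} \<union> {- w..} = UNIV" by auto
  ultimately have sum: "(LBINT x:{..- w}. ?q x) + (LBINT x:{- w..}. ?q x) = 0"
    by (simp add: set_lebesgue_integral_def)
  have "(LBINT x:{w..}. std_normal_density x * (h (- x) - std_normal_mean h)) = (LBINT x:{..- w}. ?q x)"
    by (subst set_integral_reflect) (simp add: le_minus_iff atMost_def)
  with sum show ?thesis
    by (simp add: stein_solution_def std_normal_mean_reflect divide_simps)
qed

lemma stein_solution_bounds:
  assumes h: "1-lipschitz_on UNIV h"
  shows "\<bar>stein_solution h w\<bar> \<le> 4" "\<bar>stein_solution_deriv h w\<bar> * (1 + w\<^sup>2) \<le> 2 * \<bar>w\<bar> + 1"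
proof -
  have "\<bar>stein_solution h w\<bar> \<le> 4 \<and> \<bar>stein_solution_deriv h w\<bar> * (1 + w\<^sup>2) \<le> 2 * \<bar>w\<bar> + 1"
  proof (cases "w \<ge> 0")
    case True
    then show ?thesis using stein_solution_bounds_nonneg[OF h True] by simp
  next
    case False
    \<comment> \<open>Reflection sends w to -w > 0, flips the sign of f and leaves f' unchanged, so
      both absolute values carry over.\<close>
    let ?h = "\<lambda>x. h (- x)"
    have "1-lipschitz_on UNIV ?h"
    proof (rule lipschitz_onI)
      show "dist (h (- x)) (h (- y)) \<le> 1 * dist x y" for x y
        using lipschitz_1_realD[OF h, of "- x" "- y"] by (simp add: dist_real_def abs_minus_commute)
    qed simp
    moreover have "stein_solution ?h (- w) = - stein_solution h w"
      using stein_solution_reflect[OF h, of "- w"] by simp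
    moreover from this have "stein_solution_deriv ?h (- w) = stein_solution_deriv h w"
      by (simp add: stein_solution_deriv_def std_normal_mean_reflect)
    ultimately show ?thesis
      using stein_solution_bounds_nonneg[of ?h "- w"] False by simp
  qed
  then show "\<bar>stein_solution h w\<bar> \<le> 4" "\<bar>stein_solution_deriv h w\<bar> * (1 + w\<^sup>2) \<le> 2 * \<bar>w\<bar> + 1"
    by auto
qed

lemma stein_solution_deriv_bounded:
  assumes h: "1-lipschitz_on UNIV h"
  shows "\<bar>stein_solution_deriv h w\<bar> \<le> 2"
proof -
  have "2 * \<bar>w\<bar> \<le> 1 + w\<^sup>2"
    using sum_squares_bound[of 1 "\<bar>w\<bar>"] by simp
  moreover have "0 \<le> w\<^sup>2" by simp
  ultimately have "2 * \<bar>w\<bar> + 1 \<le> 2 * (1 + w\<^sup>2)" by argo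
  then have "\<bar>stein_solution_deriv h w\<bar> * (1 + w\<^sup>2) \<le> 2 * (1 + w\<^sup>2)"
    using stein_solution_bounds(2)[OF h, of w] by simp
  then show ?thesis by (rule mult_right_le_imp_le) (simp add: add_pos_nonneg)
qed

text \<open>Here the weight 1 + w^2 pays off: w f' is the part of the derivative of w f that a mere
  bound on f' would leave unbounded.\<close>

lemma stein_solution_deriv_times_id_bounded:
  assumes h: "1-lipschitz_on UNIV h"
  shows "\<bar>w * stein_solution_deriv h w\<bar> \<le> 3"
proof -
  have "\<bar>w\<bar> * (\<bar>stein_solution_deriv h w\<bar> * (1 + w\<^sup>2)) \<le> \<bar>w\<bar> * (2 * \<bar>w\<bar> + 1)"
    using stein_solution_bounds(2)[OF h, of w] by (rule mult_left_mono) simp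
  also have "\<dots> = 2 * w\<^sup>2 + \<bar>w\<bar>"
    by (simp add: distrib_left power2_eq_square)
  also have "\<dots> \<le> 3 * (1 + w\<^sup>2)"
    using sum_squares_bound[of 1 "\<bar>w\<bar>"] by simp
  finally have "\<bar>w * stein_solution_deriv h w\<bar> * (1 + w\<^sup>2) \<le> 3 * (1 + w\<^sup>2)"
    by (simp add: abs_mult mult_ac)
  then show ?thesis by (rule mult_right_le_imp_le) (simp add: add_pos_nonneg)
qed

text \<open>Up to a constant f' is h + w f. The first summand contributes 1; the second has
  derivative f + w f', bounded by 4 + 3.\<close>

lemma stein_solution_deriv_lipschitz:
  assumes h: "1-lipschitz_on UNIV h"
  shows "\<bar>stein_solution_deriv h x - stein_solution_deriv h y\<bar> \<le> 8 * \<bar>x - y\<bar>"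
proof -
  let ?k = "\<lambda>w. w * stein_solution h w"
  have "norm (?k x - ?k y) \<le> 7 * norm (x - y)"
  proof (rule field_differentiable_bound[of UNIV])
    fix w :: real
    show "(?k has_real_derivative stein_solution h w + w * stein_solution_deriv h w) (at w within UNIV)"
      by (auto intro!: derivative_eq_intros DERIV_stein_solution[OF h])
    show "norm (stein_solution h w + w * stein_solution_deriv h w) \<le> 7"
      using stein_solution_bounds(1)[OF h, of w] stein_solution_deriv_times_id_bounded[OF h, of w]
      by simp
  qed auto
  then have "\<bar>?k x - ?k y\<bar> \<le> 7 * \<bar>x - y\<bar>" by simp
  moreover have "stein_solution_deriv h x - stein_solution_deriv h y = (h x - h y) + (?k x - ?k y)"
    by (simp add: stein_solution_deriv_def)
  ultimately show ?thesis
    using lipschitz_1_realD[OF h, of x y] abs_triangle_ineq[of "h x - h y" "?k x - ?k y"] by argo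
qed

subsection \<open>The urn\<close>

lemma UNIV_color: "(UNIV :: color set) = {White, Black}"
  using color.exhaust by auto

lemma finite_color_set [simp]: "finite (C :: color set)"
  by (rule finite_subset[OF subset_UNIV]) (simp add: UNIV_color)

lemma white_draws_simps [simp]:
  "white_draws (White # cs) = Suc (white_draws cs)"
  "white_draws (Black # cs) = white_draws cs"
  by (simp_all add: white_draws_def)

lemma white_plus_black_draws: "white_draws cs + count_list cs Black = length cs"
proof (induction cs)
  case (Cons c cs)
  then show ?case by (cases c) auto
qed (simp add: white_draws_def)

lemma length_polya_draws: "cs \<in> set_pmf (polya_draws m A B n) \<Longrightarrow> length cs = n"
  by (induction n arbitrary: cs) auto

lemma finite_set_polya_draws: "finite (set_pmf (polya_draws m A B n))"
proof (rule finite_subset)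
  show "set_pmf (polya_draws m A B n) \<subseteq> {cs. set cs \<subseteq> UNIV \<and> length cs = n}"
    using length_polya_draws by auto
qed (rule finite_lists_length_eq, simp)

lemma integrable_polya_draws:
  fixes f :: "color list \<Rightarrow> real"
  shows "integrable (measure_pmf (polya_draws m A B n)) f"
  by (rule integrable_measure_pmf_finite) (rule finite_set_polya_draws)

text \<open>Conditioning on the first n draws. Every expectation over the urn is computed from this
  recursion, without the explicit law of S.\<close>

lemma expectation_polya_draws_Suc:
  fixes f :: "color list \<Rightarrow> real"
  assumes "A > 0"
  shows "measure_pmf.expectation (polya_draws m A B (Suc n)) f =
    measure_pmf.expectation (polya_draws m A B n) (\<lambda>cs.
      (real A + real (white_draws cs) * real m) * f (White # cs)
      + (real B + (real n - real (white_draws cs)) * real m) * f (Black # cs))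
    / (real A + real B + real n * real m)"
proof -
  let ?P = "polya_draws m A B n"
  let ?f = "\<lambda>cs. (real A + real (white_draws cs) * real m) * f (White # cs)
      + (real B + (real n - real (white_draws cs)) * real m) * f (Black # cs)"
  let ?K = "\<lambda>cs. map_pmf (\<lambda>c. c # cs) (pmf_of_multiset (urn_contents m A B cs))"
  have "pmf ?P cs * measure_pmf.expectation (?K cs) f =
        pmf ?P cs * (?f cs / (real A + real B + real n * real m))"
    if cs: "cs \<in> set_pmf ?P" for cs
  proof -
    have b: "real (count_list cs Black) = real n - real (white_draws cs)"
      using white_plus_black_draws[of cs] length_polya_draws[OF cs] by simp
    have w: "count_list cs White = white_draws cs"
      by (simp add: white_draws_def)
    \<comment> \<open>The mass function of \<open>pmf_of_multiset\<close> is available for nonempty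
      multisets; the A initial white balls guarantee this.\<close>
    have ne: "urn_contents m A B cs \<noteq> {#}"
      using assms by (auto simp: urn_contents_def)
    have sz: "real (size (urn_contents m A B cs)) = real A + real B + real n * real m"
      using length_polya_draws[OF cs] by (simp add: urn_contents_def mult.commute)
    have "measure_pmf.expectation (?K cs) f =
        (\<Sum>c\<in>UNIV. f (c # cs) * pmf (pmf_of_multiset (urn_contents m A B cs)) c)"
      by (simp, rule integral_measure_pmf_real) simp_all
    also have "\<dots> = ?f cs / (real A + real B + real n * real m)"
      unfolding UNIV_color pmf_of_multiset[OF ne] sz
      by (simp add: urn_contents_def count_mset w b)
         (simp add: add_divide_distrib[symmetric] mult.commute)
    finally show ?thesis by simp
  qed
  then have "measure_pmf.expectation (polya_draws m A B (Suc n)) f =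
      (\<Sum>cs\<in>set_pmf ?P. pmf ?P cs * (?f cs / (real A + real B + real n * real m)))"
    unfolding polya_draws.simps
    by (subst pmf_expectation_bind[OF finite_set_polya_draws])
       (auto simp: finite_set_polya_draws intro!: sum.cong)
  also have "\<dots> = measure_pmf.expectation ?P (\<lambda>cs. ?f cs / (real A + real B + real n * real m))"
    by (subst integral_measure_pmf[OF finite_set_polya_draws[of m A B n]]) (auto simp: mult.commute)
  finally show ?thesis by simp
qed

abbreviation (input) polya_E :: "nat \<Rightarrow> nat \<Rightarrow> nat \<Rightarrow> nat \<Rightarrow> (color list \<Rightarrow> real) \<Rightarrow> real" where
  "polya_E m A B n f \<equiv> measure_pmf.expectation (polya_draws m A B n) f"

text \<open>This says k (B + (n - k) m) P(S = k) = (n - k + 1) (A + (k - 1) m) P(S = k - 1), the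
  ratio of consecutive beta-binomial weights. Testing against arbitrary g, with g general in the
  induction, avoids the explicit weights.\<close>

lemma polya_detailed_balance:
  fixes g :: "nat \<Rightarrow> real"
  assumes "A > 0"
  shows "polya_E m A B n (\<lambda>cs. real (white_draws cs) * (real B + (real n - real (white_draws cs)) * real m) * g (white_draws cs))
    = polya_E m A B n (\<lambda>cs. (real n - real (white_draws cs)) * (real A + real (white_draws cs) * real m) * g (Suc (white_draws cs)))"
proof (induction n arbitrary: g)
  case 0
  show ?case by (simp add: white_draws_def)
next
  case (Suc n)
  let ?S = white_draws and ?E = "polya_E m A B n"
  let ?a = "\<lambda>k. real A + real k * real m"
  let ?b = "\<lambda>k. real B + (real n - real k) * real m"
  note [simp] = integrable_polya_draws
  \<comment> \<open>Splitting by the color of the last draw, \<open>down\<close> rewrites the black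
    term of the left side and \<open>up\<close> produces the white term of the right side. In each,
    the induction hypothesis is used with g multiplied by a ball count.\<close>
  have up: "?E (\<lambda>cs. real (?S cs) * ?b (?S cs) * (?a (?S cs) * g (Suc (?S cs)))) =
      ?E (\<lambda>cs. (real n - real (?S cs)) * ?a (?S cs) * (?a (Suc (?S cs)) * g (Suc (Suc (?S cs)))))"
    using Suc.IH[of "\<lambda>k. ?a k * g (Suc k)"] by simp
  have down: "?E (\<lambda>cs. real (?S cs) * ?b (?S cs) * ((real B + (real (Suc n) - real (?S cs)) * real m) * g (?S cs))) =
      ?E (\<lambda>cs. (real n - real (?S cs)) * ?a (?S cs) * (?b (?S cs) * g (Suc (?S cs))))"
    using Suc.IH[of "\<lambda>k. (real B + (real (Suc n) - real k) * real m) * g k"]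
    unfolding of_nat_Suc add_diff_cancel_left .
  have "?E (\<lambda>cs. ?a (?S cs) * (real (?S cs) + 1) * ?b (?S cs) * g (Suc (?S cs))
         + real (?S cs) * ?b (?S cs) * ((real B + (real (Suc n) - real (?S cs)) * real m) * g (?S cs)))
      = ?E (\<lambda>cs. ?a (?S cs) * (real (?S cs) + 1) * ?b (?S cs) * g (Suc (?S cs))
         + (real n - real (?S cs)) * ?a (?S cs) * (?b (?S cs) * g (Suc (?S cs))))"
    using down by simp
  \<comment> \<open>In both expressions g (S + 1) has the total coefficient (n + 1) a b: (S + 1) +
    (n - S) on one side, (n + 1 - S) + S on the other.\<close>
  also have "\<dots> = ?E (\<lambda>cs. (real (Suc n) - real (?S cs)) * ?a (?S cs) * ?b (?S cs) * g (Suc (?S cs))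
         + real (?S cs) * ?b (?S cs) * (?a (?S cs) * g (Suc (?S cs))))"
    by (intro Bochner_Integration.integral_cong refl) (simp add: algebra_simps)
  also have "\<dots> = ?E (\<lambda>cs. (real (Suc n) - real (?S cs)) * ?a (?S cs) * ?b (?S cs) * g (Suc (?S cs))
         + (real n - real (?S cs)) * ?a (?S cs) * (?a (Suc (?S cs)) * g (Suc (Suc (?S cs)))))"
    by (simp add: up)
  finally have eq: "?E (\<lambda>cs. ?a (?S cs) * (real (?S cs) + 1) * ?b (?S cs) * g (Suc (?S cs))
         + real (?S cs) * ?b (?S cs) * ((real B + (real (Suc n) - real (?S cs)) * real m) * g (?S cs)))
      = ?E (\<lambda>cs. (real (Suc n) - real (?S cs)) * ?a (?S cs) * ?b (?S cs) * g (Suc (?S cs))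
         + (real n - real (?S cs)) * ?a (?S cs) * (?a (Suc (?S cs)) * g (Suc (Suc (?S cs)))))" .
  show ?case
    unfolding expectation_polya_draws_Suc[OF assms(1)]
    using eq
    by (simp add: mult_ac add_ac)
qed


text \<open>The two rates in the detailed balance have the same quadratic part, so their difference
  is the affine function nA - (A + B) S, a multiple of W.\<close>

lemma polya_stein_identity:
  fixes g :: "nat \<Rightarrow> real"
  assumes "A > 0"
  shows "polya_E m A B n (\<lambda>cs. (real n * real A - (real A + real B) * real (white_draws cs)) * g (white_draws cs))
    = polya_E m A B n (\<lambda>cs. (real n - real (white_draws cs)) * (real A + real (white_draws cs) * real m)
        * (g (white_draws cs) - g (Suc (white_draws cs))))"
proof -
  let ?S = "\<lambda>cs. real (white_draws cs)"
  note [simp] = integrable_polya_draws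
  have "polya_E m A B n (\<lambda>cs. (real n * real A - (real A + real B) * ?S cs) * g (white_draws cs))
    = polya_E m A B n (\<lambda>cs. (real n - ?S cs) * (real A + ?S cs * real m) * g (white_draws cs)
        - ?S cs * (real B + (real n - ?S cs) * real m) * g (white_draws cs))"
    by (intro Bochner_Integration.integral_cong refl) (simp add: algebra_simps)
  also have "\<dots> = polya_E m A B n (\<lambda>cs. (real n - ?S cs) * (real A + ?S cs * real m) * g (white_draws cs)
        - (real n - ?S cs) * (real A + ?S cs * real m) * g (Suc (white_draws cs)))"
    using polya_detailed_balance[OF assms, of m B n g] by simp
  finally show ?thesis by (simp add: right_diff_distrib)
qed

section \<open>First two moments of the number of white draws\<close>

lemma polya_E_white_draws:
  assumes "A > 0"
  shows "polya_E m A B n (\<lambda>cs. real (white_draws cs)) = real n * real A / (real A + real B)"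
proof -
  note [simp] = integrable_polya_draws
  have "real n * real A - (real A + real B) * polya_E m A B n (\<lambda>cs. real (white_draws cs)) = 0"
    using polya_stein_identity[OF assms, of m B n "\<lambda>_. 1"] by simp
  with assms show ?thesis by (simp add: field_simps)
qed

text \<open>The Stein identity for g(k) = k: the difference g(S) - g(S + 1) is -1 and the rate is
  quadratic in S, so the identity closes on the first two moments.\<close>

lemma polya_E_white_draws_square:
  assumes "A > 0"
  shows "(real A + real B + real m) * polya_E m A B n (\<lambda>cs. (real (white_draws cs))\<^sup>2) =
    real n * real A + (real n * real A + real n * real m - real A) * (real n * real A / (real A + real B))"
proof -
  let ?S = "\<lambda>cs. real (white_draws cs)" and ?E = "polya_E m A B n"
  note [simp] = integrable_polya_draws
  have "?E (\<lambda>cs. real n * real A * ?S cs - (real A + real B) * (?S cs)\<^sup>2)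
      = ?E (\<lambda>cs. real m * (?S cs)\<^sup>2 - (real n * real m - real A) * ?S cs - real n * real A)"
    using polya_stein_identity[OF assms, of m B n real]
    by (simp add: algebra_simps power2_eq_square)
  then have "real n * real A * ?E ?S - (real A + real B) * ?E (\<lambda>cs. (?S cs)\<^sup>2)
      = real m * ?E (\<lambda>cs. (?S cs)\<^sup>2) - (real n * real m - real A) * ?E ?S - real n * real A"
    by simp
  then have "(real A + real B + real m) * ?E (\<lambda>cs. (?S cs)\<^sup>2) =
      real n * real A + (real n * real A + real n * real m - real A) * ?E ?S"
    by (simp add: algebra_simps)
  then show ?thesis by (simp add: polya_E_white_draws[OF assms])
qed

text \<open>The factor kappa in W = kappa (nA - (A + B) S), the reciprocal of the standard deviation
  of the bracket for positive A, B and n. One more white draw lowers W by kappa (A + B).\<close>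

definition polya_scale :: "nat \<Rightarrow> nat \<Rightarrow> nat \<Rightarrow> nat \<Rightarrow> real" where
  "polya_scale m A B n = sqrt ((real A + real B + real m) /
     (real n * real A * real B * (real A + real B + real n * real m)))"

lemma polya_scale_square:
  "(polya_scale m A B n)\<^sup>2 = (real A + real B + real m) /
     (real n * real A * real B * (real A + real B + real n * real m))"
  by (simp add: polya_scale_def)

lemma polya_scale_pos:
  assumes "A > 0" "B > 0" "n > 0"
  shows "polya_scale m A B n > 0"
  using assms by (simp add: polya_scale_def add_pos_nonneg)

lemma polya_W_eq:
  assumes "n > 0"
  shows "polya_W m A B n cs =
    polya_scale m A B n * (real n * real A - (real A + real B) * real (white_draws cs))"
proof -
  let ?q = "(real A + real B + real m) / (real n * real A * real B * (real A + real B + real n * real m))"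
  have "(real A + real B + real m) * real n / (real A * real B * (real A + real B + real n * real m))
      = (real n)\<^sup>2 * ?q"
    using assms by (simp add: power2_eq_square mult_ac)
  then have "sqrt ((real A + real B + real m) * real n / (real A * real B * (real A + real B + real n * real m)))
      = real n * sqrt ?q"
    by (simp only: real_sqrt_mult real_sqrt_abs abs_of_nat)
  then have "polya_W m A B n cs = real n * sqrt ?q *
      (real A - (real A + real B) * real (white_draws cs) / real n)"
    by (simp only: polya_W_def)
  also have "\<dots> = sqrt ?q * (real n * real A - (real A + real B) * real (white_draws cs))"
    using assms by (simp add: field_simps)
  finally show ?thesis by (simp add: polya_scale_def)
qed

lemma polya_E_polya_W:
  assumes "A > 0" "n > 0"
  shows "polya_E m A B n (polya_W m A B n) = 0"
proof -
  note [simp] = integrable_polya_draws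
  show ?thesis
    using assms by (simp add: polya_W_eq[OF assms(2), abs_def] polya_E_white_draws)
qed

lemma polya_E_polya_W_square:
  assumes "A > 0" "B > 0" "n > 0"
  shows "polya_E m A B n (\<lambda>cs. (polya_W m A B n cs)\<^sup>2) = 1"
proof -
  note [simp] = integrable_polya_draws
  define a b N M D where "a = real A" "b = real B" "N = real n" "M = real m" "D = a + b"
  note defs = this
  have pos: "a > 0" "b > 0" "N > 0" "M \<ge> 0" "D > 0"
    using assms by (auto simp: defs)
  let ?S = "\<lambda>cs. real (white_draws cs)" and ?E = "polya_E m A B n"
  define Q where "Q = ?E (\<lambda>cs. (?S cs)\<^sup>2)"
  have Q: "(D + M) * Q = N * a + (N * a + N * M - a) * (N * a / D)"
    using polya_E_white_draws_square[OF assms(1), of B m n] by (simp add: Q_def defs)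
  have "?E (\<lambda>cs. (N * a - D * ?S cs)\<^sup>2) = ?E (\<lambda>cs. (N * a)\<^sup>2 - 2 * N * a * D * ?S cs + D\<^sup>2 * (?S cs)\<^sup>2)"
    by (intro Bochner_Integration.integral_cong refl) (simp add: algebra_simps power2_eq_square)
  also have "\<dots> = (N * a)\<^sup>2 - 2 * N * a * D * (N * a / D) + D\<^sup>2 * Q"
    using polya_E_white_draws[OF assms(1), of m B n] by (simp add: Q_def defs)
  also have "\<dots> = D\<^sup>2 * Q - (N * a)\<^sup>2"
    using pos by (simp add: power2_eq_square)
  finally have V: "?E (\<lambda>cs. (N * a - D * ?S cs)\<^sup>2) = D\<^sup>2 * Q - (N * a)\<^sup>2" .
  \<comment> \<open>Multiplying by D + M clears the factor in front of the second moment; the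
    product then collapses to (D + M) / kappa^2.\<close>
  have "(D + M) * (D\<^sup>2 * Q - (N * a)\<^sup>2) = D\<^sup>2 * ((D + M) * Q) - (D + M) * (N * a)\<^sup>2"
    by (simp add: algebra_simps)
  also have "\<dots> = N * a * b * (D + N * M)"
    unfolding Q using pos defs(5) by (simp add: field_simps power2_eq_square)
  finally have DV: "(D + M) * (D\<^sup>2 * Q - (N * a)\<^sup>2) = N * a * b * (D + N * M)" .
  have nz: "N * a * b * (D + N * M) \<noteq> 0"
    using pos by (simp add: add_pos_nonneg less_imp_neq[symmetric])
  have "?E (\<lambda>cs. (polya_W m A B n cs)\<^sup>2) = (polya_scale m A B n)\<^sup>2 * ?E (\<lambda>cs. (N * a - D * ?S cs)\<^sup>2)"
    by (simp add: polya_W_eq[OF assms(3)] power_mult_distrib defs)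
  also have "\<dots> = (D + M) * (D\<^sup>2 * Q - (N * a)\<^sup>2) / (N * a * b * (D + N * M))"
    unfolding V polya_scale_square by (simp add: defs)
  also have "\<dots> = 1" unfolding DV using nz by simp
  finally show ?thesis .
qed

text \<open>As f' is only Lipschitz, the remainder is treated as a function of the step t: after
  subtracting L t^2 / 2 its derivative is nonpositive, and it vanishes at t = 0.\<close>

lemma taylor_one_sided_lipschitz_deriv:
  fixes f f' :: "real \<Rightarrow> real"
  assumes f': "\<And>x. (f has_real_derivative f' x) (at x)"
    and L: "\<And>x y. \<bar>f' x - f' y\<bar> \<le> L * \<bar>x - y\<bar>" and "u \<ge> 0"
  shows "f x - f (x - u) - u * f' x \<le> L * u\<^sup>2 / 2"
proof -
  let ?g = "\<lambda>t. f x - f (x - t) - t * f' x - L * t\<^sup>2 / 2"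
  have "?g u \<le> ?g 0"
  proof (rule DERIV_nonpos_imp_nonincreasing[OF \<open>u \<ge> 0\<close>])
    fix t :: real assume t: "0 \<le> t" "t \<le> u"
    have "((\<lambda>t. f (x - t)) has_real_derivative f' (x - t) * (0 - 1)) (at t)"
      by (rule DERIV_chain2[OF f']) (auto intro!: derivative_eq_intros)
    then have "(?g has_real_derivative f' (x - t) - f' x - L * t) (at t)"
      by (auto intro!: derivative_eq_intros)
    moreover have "f' (x - t) - f' x - L * t \<le> 0"
      using L[of "x - t" x] t by simp
    ultimately show "\<exists>y. (?g has_real_derivative y) (at t) \<and> y \<le> 0" by blast
  qed
  then show ?thesis by simp
qed

lemma taylor_lipschitz_deriv:
  fixes f f' :: "real \<Rightarrow> real"
  assumes f': "\<And>x. (f has_real_derivative f' x) (at x)"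
    and L: "\<And>x y. \<bar>f' x - f' y\<bar> \<le> L * \<bar>x - y\<bar>" and "u \<ge> 0"
  shows "\<bar>f x - f (x - u) - u * f' x\<bar> \<le> L * u\<^sup>2 / 2"
proof -
  have "- f x - - f (x - u) - u * - f' x \<le> L * u\<^sup>2 / 2"
    by (rule taylor_one_sided_lipschitz_deriv[where f = "\<lambda>x. - f x" and f' = "\<lambda>x. - f' x"])
       (use L \<open>u \<ge> 0\<close> in \<open>auto intro: DERIV_minus f' simp: abs_minus_commute[of "f' _" "f' _"]\<close>)
  with taylor_one_sided_lipschitz_deriv[OF assms, of x] show ?thesis by (intro abs_leI) simp_all
qed

section \<open>The Stein kernel and the bound for a smooth test function\<close>

lemma white_draws_le: "cs \<in> set_pmf (polya_draws m A B n) \<Longrightarrow> white_draws cs \<le> n"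
  using white_plus_black_draws[of cs] length_polya_draws[of cs m A B n] by simp

lemma polya_kernel_eq:
  fixes m A B n :: nat
  assumes "A > 0" "B > 0" "n > 0"
  defines "D \<equiv> real A + real B" and "\<kappa> \<equiv> polya_scale m A B n"
  shows "D * \<kappa>\<^sup>2 * ((real n - real (white_draws cs)) * (real A + real (white_draws cs) * real m)) - 1 =
    (\<kappa> * (real A * (D + real n * real m) - real n * real m * real B) * polya_W m A B n cs
      - real m * ((polya_W m A B n cs)\<^sup>2 - 1)) / D"
proof -
  define a b N M S Y where "a = real A" "b = real B" "N = real n" "M = real m"
    "S = real (white_draws cs)" "Y = N * a - D * S"
  note defs = this
  have pos: "a > 0" "b > 0" "N > 0" "M \<ge> 0" and D: "D = a + b"
    using assms by (auto simp: defs)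
  have W: "polya_W m A B n cs = \<kappa> * Y"
    using polya_W_eq[OF assms(3)] by (simp add: defs D_def \<kappa>_def)
  have k: "\<kappa>\<^sup>2 * (N * a * b * (D + N * M)) = D + M"
  proof -
    have "D + N * M > 0" using pos D by (simp add: add_pos_nonneg)
    then show ?thesis using pos by (simp add: polya_scale_square \<kappa>_def D_def defs)
  qed
  \<comment> \<open>Substituting D S = N a - Y factors the left side as (N b + Y) (a (D + N M) - M
    Y). After scaling by \<kappa> squared the constant term becomes D + M, whose M centers the
    square of W.\<close>
  have D2: "D\<^sup>2 * ((N - S) * (a + S * M)) =
      N * a * b * (D + N * M) + Y * (a * (D + N * M) - N * M * b) - M * Y\<^sup>2"
    unfolding defs(6) D by (simp add: algebra_simps power2_eq_square)
  have "D * (D * \<kappa>\<^sup>2 * ((N - S) * (a + S * M)) - 1) = \<kappa>\<^sup>2 * (D\<^sup>2 * ((N - S) * (a + S * M))) - D"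
    by (simp add: algebra_simps power2_eq_square)
  also have "\<dots> = \<kappa>\<^sup>2 * (N * a * b * (D + N * M)) + \<kappa>\<^sup>2 * (Y * (a * (D + N * M) - N * M * b) - M * Y\<^sup>2) - D"
    unfolding D2 by (simp add: algebra_simps)
  also have "\<dots> = \<kappa> * (a * (D + N * M) - N * M * b) * (\<kappa> * Y) - M * ((\<kappa> * Y)\<^sup>2 - 1)"
    unfolding k by (simp add: algebra_simps power2_eq_square)
  finally show ?thesis
    using pos D by (simp add: W defs eq_divide_eq mult.commute)
qed

lemma polya_stein_bound:
  fixes m A B n :: nat and f f' :: "real \<Rightarrow> real"
  assumes "A > 0" "B > 0" "n > 0"
    and f': "\<And>x. (f has_real_derivative f' x) (at x)"
    and K: "\<And>x. \<bar>f' x\<bar> \<le> K" and L: "\<And>x y. \<bar>f' x - f' y\<bar> \<le> L * \<bar>x - y\<bar>"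
  defines "D \<equiv> real A + real B" and "\<kappa> \<equiv> polya_scale m A B n"
  shows "\<bar>polya_E m A B n (\<lambda>cs. f' (polya_W m A B n cs) - polya_W m A B n cs * f (polya_W m A B n cs))\<bar>
     \<le> K * (\<kappa> * (D + real n * real m) + 2 * real m / D) + L * (\<kappa> * D) / 2"
proof -
  note [simp] = integrable_polya_draws
  let ?S = "\<lambda>cs. real (white_draws cs)" and ?W = "polya_W m A B n" and ?E = "polya_E m A B n"
  let ?lam = "\<lambda>cs. (real n - ?S cs) * (real A + ?S cs * real m)"
  define T where "T = (\<lambda>cs. D * \<kappa>\<^sup>2 * ?lam cs)"
  define c where "c = \<kappa> * (real A * (D + real n * real m) - real n * real m * real B)"
  define \<delta> where "\<delta> = \<kappa> * D"
  have D: "D > 0" and \<kappa>: "\<kappa> > 0"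
    using assms polya_scale_pos[of A B n m] by (auto simp: D_def \<kappa>_def)
  have \<delta>: "\<delta> > 0" using D \<kappa> by (simp add: \<delta>_def)
  have K0: "K \<ge> 0" using K[of 0] by linarith
  have T: "T cs - 1 = (c * ?W cs - real m * ((?W cs)\<^sup>2 - 1)) / D" for cs
    unfolding T_def c_def D_def \<kappa>_def by (rule polya_kernel_eq[OF assms(1-3)])
  have EW2: "?E (\<lambda>cs. (?W cs)\<^sup>2) = 1" and EW: "?E ?W = 0"
    using polya_E_polya_W_square[OF assms(1-3)] polya_E_polya_W[OF assms(1,3)] by auto
  \<comment> \<open>The kernel identity is linear in W and W^2 - 1, both of mean 0.\<close>
  have "?E (\<lambda>cs. T cs - 1) = 0"
    unfolding T by (simp add: EW EW2)
  then have ET: "?E T = 1" by simp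

  have W: "?W cs = \<kappa> * (real n * real A - D * ?S cs)" for cs
    using polya_W_eq[OF assms(3)] by (simp add: D_def \<kappa>_def)
  \<comment> \<open>The test function on counts is f at the value that W takes when S = k; replacing
    k by k + 1 then subtracts \<delta>.\<close>
  have "?E (\<lambda>cs. (real n * real A - D * ?S cs) * f (?W cs)) = ?E (\<lambda>cs. ?lam cs * (f (?W cs) - f (?W cs - \<delta>)))"
    using polya_stein_identity[OF assms(1), of m B n "\<lambda>k. f (\<kappa> * (real n * real A - D * real k))"]
    by (simp add: D_def[symmetric] W \<delta>_def algebra_simps)
  then have "\<kappa> * ?E (\<lambda>cs. (real n * real A - D * ?S cs) * f (?W cs)) = \<kappa> * ?E (\<lambda>cs. ?lam cs * (f (?W cs) - f (?W cs - \<delta>)))"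
    by simp
  then have WfW: "?E (\<lambda>cs. ?W cs * f (?W cs)) = ?E (\<lambda>cs. \<kappa> * ?lam cs * (f (?W cs) - f (?W cs - \<delta>)))"
    unfolding integral_mult_right_zero[symmetric] mult.assoc[symmetric] W[symmetric] .
  have eq: "?E (\<lambda>cs. f' (?W cs) - ?W cs * f (?W cs)) = ?E (\<lambda>cs. f' (?W cs) - \<kappa> * ?lam cs * (f (?W cs) - f (?W cs - \<delta>)))"
    by (simp add: WfW)
  have "\<bar>?E (\<lambda>cs. f' (?W cs) - ?W cs * f (?W cs))\<bar> \<le> ?E (\<lambda>cs. \<bar>f' (?W cs) - \<kappa> * ?lam cs * (f (?W cs) - f (?W cs - \<delta>))\<bar>)"
    unfolding eq by (rule integral_abs_bound)
  \<comment> \<open>The difference splits into f' (1 - T) and a Taylor remainder. The remainder is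
    at most \<kappa> lam L \<delta>^2 / 2 = T L \<delta> / 2, and T has mean 1. In T - 1 everything
    is majorized by 1 + W^2, of mean 2.\<close>
  also have "\<dots> \<le> ?E (\<lambda>cs. K * (\<bar>c\<bar> * ((1 + (?W cs)\<^sup>2) / 2) + real m * (1 + (?W cs)\<^sup>2)) / D + T cs * (L * \<delta> / 2))"
  proof (rule integral_mono_AE)
    show "AE cs in polya_draws m A B n. \<bar>f' (?W cs) - \<kappa> * ?lam cs * (f (?W cs) - f (?W cs - \<delta>))\<bar>
       \<le> K * (\<bar>c\<bar> * ((1 + (?W cs)\<^sup>2) / 2) + real m * (1 + (?W cs)\<^sup>2)) / D + T cs * (L * \<delta> / 2)"
    proof (rule AE_pmfI)
      fix cs assume cs: "cs \<in> set_pmf (polya_draws m A B n)"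
      have lam: "?lam cs \<ge> 0"
        using white_draws_le[OF cs] by simp
      have "\<bar>?W cs\<bar> \<le> (1 + (?W cs)\<^sup>2) / 2"
        using sum_squares_bound[of 1 "\<bar>?W cs\<bar>"] by simp
      then have "\<bar>c * ?W cs\<bar> \<le> \<bar>c\<bar> * ((1 + (?W cs)\<^sup>2) / 2)"
        unfolding abs_mult by (intro mult_left_mono) auto
      moreover have "\<bar>(?W cs)\<^sup>2 - 1\<bar> \<le> 1 + (?W cs)\<^sup>2"
        by (simp add: abs_le_iff)
      then have "\<bar>real m * ((?W cs)\<^sup>2 - 1)\<bar> \<le> real m * (1 + (?W cs)\<^sup>2)"
        unfolding abs_mult by (intro mult_mono) auto
      ultimately have "\<bar>c * ?W cs - real m * ((?W cs)\<^sup>2 - 1)\<bar> \<le> \<bar>c\<bar> * ((1 + (?W cs)\<^sup>2) / 2) + real m * (1 + (?W cs)\<^sup>2)"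
        by linarith
      then have T1: "\<bar>T cs - 1\<bar> \<le> (\<bar>c\<bar> * ((1 + (?W cs)\<^sup>2) / 2) + real m * (1 + (?W cs)\<^sup>2)) / D"
        unfolding T using D by (simp add: abs_divide divide_right_mono)
      have "\<bar>f' (?W cs) - \<kappa> * ?lam cs * (f (?W cs) - f (?W cs - \<delta>))\<bar> =
          \<bar>f' (?W cs) * (1 - T cs) - \<kappa> * ?lam cs * (f (?W cs) - f (?W cs - \<delta>) - \<delta> * f' (?W cs))\<bar>"
        by (rule arg_cong[where f = abs]) (simp add: T_def \<delta>_def algebra_simps power2_eq_square)
      also have "\<dots> \<le> \<bar>f' (?W cs) * (1 - T cs)\<bar> + \<bar>\<kappa> * ?lam cs * (f (?W cs) - f (?W cs - \<delta>) - \<delta> * f' (?W cs))\<bar>"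
        by (rule abs_triangle_ineq4)
      also have "\<dots> = \<bar>f' (?W cs)\<bar> * \<bar>T cs - 1\<bar> + \<bar>\<kappa> * ?lam cs\<bar> * \<bar>f (?W cs) - f (?W cs - \<delta>) - \<delta> * f' (?W cs)\<bar>"
        unfolding abs_mult by (simp only: abs_minus_commute[of 1])
      also have "\<dots> \<le> K * ((\<bar>c\<bar> * ((1 + (?W cs)\<^sup>2) / 2) + real m * (1 + (?W cs)\<^sup>2)) / D) + \<kappa> * ?lam cs * (L * \<delta>\<^sup>2 / 2)"
        by (intro add_mono mult_mono K T1 taylor_lipschitz_deriv f' L K0) (use lam \<kappa> \<delta> in auto)
      also have "\<kappa> * ?lam cs * (L * \<delta>\<^sup>2 / 2) = T cs * (L * \<delta> / 2)"
        by (simp add: T_def \<delta>_def power2_eq_square)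
      finally show "\<bar>f' (?W cs) - \<kappa> * ?lam cs * (f (?W cs) - f (?W cs - \<delta>))\<bar>
       \<le> K * (\<bar>c\<bar> * ((1 + (?W cs)\<^sup>2) / 2) + real m * (1 + (?W cs)\<^sup>2)) / D + T cs * (L * \<delta> / 2)"
        by simp
    qed
  qed simp_all
  also have "\<dots> = K * (\<bar>c\<bar> + real m * 2) / D + L * \<delta> / 2"
    by (simp add: EW2 ET)
  also have "\<dots> \<le> K * (\<kappa> * (D + real n * real m) + 2 * real m / D) + L * \<delta> / 2"
  proof -
    let ?t = "real n * real m"
    have "\<bar>real A * (D + ?t) - ?t * real B\<bar> \<le> D * (D + ?t)"
      unfolding D_def by (rule abs_leI) (auto simp: algebra_simps)
    then have "\<bar>c\<bar> \<le> \<kappa> * (D * (D + ?t))"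
      unfolding c_def abs_mult using \<kappa> by simp
    then have "\<bar>c\<bar> / D \<le> \<kappa> * (D + ?t)"
      using D by (simp add: divide_le_eq mult_ac)
    then have "K * (\<bar>c\<bar> / D + 2 * real m / D) \<le> K * (\<kappa> * (D + ?t) + 2 * real m / D)"
      using K0 by (intro mult_left_mono) auto
    then show ?thesis by (simp add: add_divide_distrib ring_distribs mult.commute)
  qed
  finally show ?thesis by (simp add: \<delta>_def)
qed

text \<open>This absorbs the summand 2m/D, leaving a bound proportional to \<kappa>. After squaring
  it follows from 4AB <= D^2 and m^2 n <= (D + m) (D + nm).\<close>

lemma polya_kernel_variation_le:
  fixes m A B n :: nat
  assumes "A > 0" "B > 0" "n > 0"
  defines "D \<equiv> real A + real B" and "\<kappa> \<equiv> polya_scale m A B n"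
  shows "2 * real m / D \<le> \<kappa> * (D + real n * real m)"
proof (rule power2_le_imp_le)
  have pos: "real A > 0" "real B > 0" "real n > 0" "D > 0" "D + real n * real m > 0"
    using assms by (auto simp: add_pos_nonneg)
  have "4 * (real A * real B) \<le> D\<^sup>2"
    using sum_squares_bound[of "real A" "real B"] by (simp add: D_def power2_eq_square algebra_simps)
  then have "4 * (real A * real B) * ((real m)\<^sup>2 * real n) \<le> D\<^sup>2 * ((real m)\<^sup>2 * real n)"
    by (intro mult_right_mono) auto
  also have "(real m)\<^sup>2 * real n \<le> (D + real m) * (D + real n * real m)"
    using pos by (simp add: algebra_simps power2_eq_square)
  then have "D\<^sup>2 * ((real m)\<^sup>2 * real n) \<le> D\<^sup>2 * ((D + real m) * (D + real n * real m))"
    by (intro mult_left_mono) auto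
  finally have "4 * (real m)\<^sup>2 / D\<^sup>2 \<le> (D + real m) * (D + real n * real m) / (real n * real A * real B)"
    using pos by (simp add: field_simps)
  also have "\<dots> = (\<kappa> * (D + real n * real m))\<^sup>2"
    unfolding \<kappa>_def power_mult_distrib polya_scale_square D_def[symmetric] using pos by (simp add: power2_eq_square)
  finally show "(2 * real m / D)\<^sup>2 \<le> (\<kappa> * (D + real n * real m))\<^sup>2"
    by (simp add: power_divide power_mult_distrib)
  show "0 \<le> \<kappa> * (D + real n * real m)"
    using pos polya_scale_pos[OF assms(1-3), of m] by (simp add: \<kappa>_def)
qed

subsection \<open>The normal approximation\<close>

lemma distr_std_normal_eq_density:
  assumes "distributed M lborel Z (\<lambda>x. ennreal (std_normal_density x))"
  shows "distr M borel Z = density lborel (\<lambda>x. ennreal (std_normal_density x))"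
proof -
  have "distr M borel Z = distr M lborel Z" by (rule distr_cong) auto
  then show ?thesis using distributed_distr_eq_density[OF assms] by simp
qed

lemma L1_dist_polya_W_std_normal:
  assumes "A > 0" "B > 0" "n > 0"
    and "prob_space M" and Z: "distributed M lborel Z (\<lambda>x. ennreal (std_normal_density x))"
  shows "L1_dist (distr (polya_draws m A B n) borel (polya_W m A B n)) (distr M borel Z)
    \<le> ennreal (polya_scale m A B n * (8 * (real A + real B) + 4 * real n * real m))"
proof (rule L1_dist_le_lipschitz)
  let ?\<kappa> = "polya_scale m A B n" and ?D = "real A + real B"
  interpret M: prob_space M by fact
  note \<nu> = distr_std_normal_eq_density[OF Z]
  have meas: "polya_W m A B n \<in> measurable (measure_pmf (polya_draws m A B n)) borel" by simp
  show "real_distribution (distr (polya_draws m A B n) borel (polya_W m A B n))"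
    by (rule prob_space.real_distribution_distr[OF prob_space_measure_pmf]) simp
  show "real_distribution (distr M borel Z)"
    using distributed_measurable[OF Z] by (intro M.real_distribution_distr) simp
  show "integrable (distr (polya_draws m A B n) borel (polya_W m A B n)) (\<lambda>x. x)"
    by (subst integrable_distr_eq[OF meas]) (simp_all add: integrable_polya_draws)
  show "integrable (distr M borel Z) (\<lambda>x. x)"
    unfolding \<nu> by (subst integrable_density) (simp_all add: integrable_std_normal_id)
  fix h :: "real \<Rightarrow> real" assume h: "1-lipschitz_on UNIV h"
  note [measurable] = lipschitz_1_borel[OF h]
  have "(LINT x|distr (polya_draws m A B n) borel (polya_W m A B n). h x) - (LINT x|distr M borel Z. h x)
      = polya_E m A B n (\<lambda>cs. h (polya_W m A B n cs)) - std_normal_mean h"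
    unfolding \<nu> by (subst integral_distr[OF meas], simp, subst integral_density) (simp_all add: std_normal_mean_def)
  also have "\<dots> = polya_E m A B n (\<lambda>cs. h (polya_W m A B n cs) - std_normal_mean h)"
    by (simp add: integrable_polya_draws)
  also have "\<dots> = polya_E m A B n (\<lambda>cs. stein_solution_deriv h (polya_W m A B n cs)
      - polya_W m A B n cs * stein_solution h (polya_W m A B n cs))"
    by (simp add: stein_solution_deriv_def)
  \<comment> \<open>The general bound with K = 2 and L = 8, the constants for f' of the Stein
    solution.\<close>
  also have "\<dots> \<le> 2 * (?\<kappa> * (?D + real n * real m) + 2 * real m / ?D) + 8 * (?\<kappa> * ?D) / 2"
    by (rule order_trans[OF abs_ge_self polya_stein_bound[OF assms(1-3)]])
       (intro DERIV_stein_solution stein_solution_deriv_bounded stein_solution_deriv_lipschitz h)+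
  also have "\<dots> \<le> 2 * (?\<kappa> * (?D + real n * real m) + ?\<kappa> * (?D + real n * real m)) + 8 * (?\<kappa> * ?D) / 2"
    using polya_kernel_variation_le[OF assms(1-3), of m] by simp
  also have "\<dots> = ?\<kappa> * (8 * ?D + 4 * real n * real m)"
    by (simp add: algebra_simps)
  finally show "(LINT x|distr (polya_draws m A B n) borel (polya_W m A B n). h x) - (LINT x|distr M borel Z. h x)
      \<le> ?\<kappa> * (8 * ?D + 4 * real n * real m)" .
qed

theorem theorem5p1:
  fixes m A B :: nat
  assumes "m > 0" and "A > 0" and "B > 0"
  shows "(\<forall>n\<ge>1.
            measure_pmf.expectation (polya_draws m A B n) (polya_W m A B n) = 0 \<and>
            measure_pmf.variance (polya_draws m A B n) (polya_W m A B n) = 1) \<and>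
         (\<forall>(M :: 'z measure) (Z :: 'z \<Rightarrow> real) (n :: nat).
            prob_space M \<longrightarrow> distributed M lborel Z (\<lambda>x. ennreal (std_normal_density x)) \<longrightarrow>
            (real n \<ge> (real A + real B + real m) / (2 * real m) \<longrightarrow>
              L1_dist (distr (polya_draws m A B (n + 1)) borel (polya_W m A B (n + 1))) (distr M borel Z)
              \<le> ennreal
                ((4 * real m * real n / (real A + real B + real m)
                  + (real A ^ 2 + 6 * real A * real B + real B ^ 2) / (real A * real B)) *
                 sqrt ((real A + real B + real m) ^ 3 /
                       (real A * real B * (real A + real B + real n * real m + real m) * (real n + 1))))) \<and>
            (real n < (real A + real B + real m) / (2 * real m) \<longrightarrow>
              L1_dist (distr (polya_draws m A B (n + 1)) borel (polya_W m A B (n + 1))) (distr M borel Z)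
              \<le> ennreal
                ((real A ^ 2 + 8 * real A * real B + real B ^ 2) / (real A * real B) *
                 sqrt ((real A + real B + real m) ^ 3 /
                       (real A * real B * (real A + real B + real n * real m + real m) * (real n + 1))))))"
proof (intro conjI allI impI)
  fix n :: nat assume n: "n \<ge> 1"
  then show E: "measure_pmf.expectation (polya_draws m A B n) (polya_W m A B n) = 0"
    using assms by (intro polya_E_polya_W) auto
  show "measure_pmf.variance (polya_draws m A B n) (polya_W m A B n) = 1"
    using n assms polya_E_polya_W_square[of A B n m] by (simp add: E)
next
  fix M :: "'z measure" and Z :: "'z \<Rightarrow> real" and n :: nat
  assume M: "prob_space M" and Z: "distributed M lborel Z (\<lambda>x. ennreal (std_normal_density x))"
  define a b k t where "a = real A" "b = real B" "k = real m" "t = real n"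
  note defs = this
  have pos: "a > 0" "b > 0" "k > 0" "t \<ge> 0" using assms by (simp_all add: defs)
  define r where "r = sqrt ((a + b + k) ^ 3 / (a * b * (a + b + t * k + k) * (t + 1)))"
  have r0: "r \<ge> 0" using pos by (simp add: r_def)
  have r: "r = (a + b + k) * polya_scale m A B (n + 1)"
  proof -
    have "(a + b + k) ^ 3 / (a * b * (a + b + t * k + k) * (t + 1)) =
        (a + b + k)\<^sup>2 * ((a + b + k) / ((t + 1) * a * b * (a + b + (t + 1) * k)))"
      by (simp add: power2_eq_square power3_eq_cube algebra_simps)
    then show ?thesis
      using pos unfolding r_def polya_scale_def
      by (simp only: real_sqrt_mult real_sqrt_abs) (simp add: defs add.commute)
  qed
  have "polya_scale m A B (n + 1) * (8 * (a + b) + 4 * real (n + 1) * k) =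
      r / (a + b + k) * (8 * (a + b) + 4 * (t + 1) * k)"
    using pos by (simp add: r defs(4) add.commute)
  \<comment> \<open>Having n + 1 draws instead of n costs 4 k, less than the 8 k gained by enlarging
    a + b to a + b + k, which then cancels the denominator.\<close>
  also have "\<dots> \<le> r / (a + b + k) * (8 * (a + b + k) + 4 * k * t)"
    using pos r0 by (intro mult_left_mono) (auto simp: algebra_simps)
  also have "\<dots> = (4 * k * t / (a + b + k) + 8) * r"
    using pos by (simp add: field_simps)
  finally have le: "polya_scale m A B (n + 1) * (8 * (a + b) + 4 * real (n + 1) * k)
      \<le> (4 * k * t / (a + b + k) + 8) * r" .
  have D: "L1_dist (distr (polya_draws m A B (n + 1)) borel (polya_W m A B (n + 1))) (distr M borel Z)
      \<le> ennreal C" if "(4 * k * t / (a + b + k) + 8) * r \<le> C" for C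
    using L1_dist_polya_W_std_normal[of A B "n + 1" M Z m] assms M Z le that
    by (auto simp: defs intro: order_trans ennreal_leI)
  \<comment> \<open>Hence 8 is at most 6 plus this ratio, which is the second summand of the first
    bound.\<close>
  have q: "2 \<le> (a\<^sup>2 + b\<^sup>2) / (a * b)"
    using pos sum_squares_bound[of a b] by (simp add: le_divide_eq)
  {
    have "(a\<^sup>2 + 6 * a * b + b\<^sup>2) / (a * b) = (a\<^sup>2 + b\<^sup>2) / (a * b) + 6"
      using pos by (simp add: field_simps)
    then have "(4 * k * t / (a + b + k) + 8) * r \<le>
        (4 * k * t / (a + b + k) + (a\<^sup>2 + 6 * a * b + b\<^sup>2) / (a * b)) * r"
      using q r0 by (intro mult_right_mono) auto
    from D[OF this, unfolded r_def]
    show "L1_dist (distr (polya_draws m A B (n + 1)) borel (polya_W m A B (n + 1))) (distr M borel Z)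
      \<le> ennreal
        ((4 * real m * real n / (real A + real B + real m)
          + (real A ^ 2 + 6 * real A * real B + real B ^ 2) / (real A * real B)) *
         sqrt ((real A + real B + real m) ^ 3 /
               (real A * real B * (real A + real B + real n * real m + real m) * (real n + 1))))"
      unfolding defs .
  next
    assume "real n < (real A + real B + real m) / (2 * real m)"
    then have "4 * k * t / (a + b + k) < 2"
      using pos unfolding defs[symmetric] by (simp add: field_simps)
    moreover have "(a\<^sup>2 + 8 * a * b + b\<^sup>2) / (a * b) = (a\<^sup>2 + b\<^sup>2) / (a * b) + 8"
      using pos by (simp add: field_simps)
    \<comment> \<open>Here the ratio of at least 2 absorbs the term with t, which lies below 2,
      while the 8 is kept.\<close>
    ultimately have "(4 * k * t / (a + b + k) + 8) * r \<le> (a\<^sup>2 + 8 * a * b + b\<^sup>2) / (a * b) * r"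
      using q r0 by (intro mult_right_mono) auto
    from D[OF this, unfolded r_def]
    show "L1_dist (distr (polya_draws m A B (n + 1)) borel (polya_W m A B (n + 1))) (distr M borel Z)
      \<le> ennreal
        ((real A ^ 2 + 8 * real A * real B + real B ^ 2) / (real A * real B) *
         sqrt ((real A + real B + real m) ^ 3 /
               (real A * real B * (real A + real B + real n * real m + real m) * (real n + 1))))"
      unfolding defs .
  }
qed

end
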